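(* Let $n\geqslant 3$ and let $\mathcal{MDI}_n$ be the monoid of all monotone partial isometries of the cycle graph $C_n$. Then $$|\mathcal{MDI}_n|= 3\cdot2^{n+1}+\frac{(n+1)n(n-1)}{3} -\frac{5+(-1)^n}{4}n^2 -4n-5.$$
   Context: Let $\Omega_n=\{1<2<\cdots<n\}$. A partial transformation of $\Omega_n$ is a map $\alpha$ from a subset $\mathrm{Dom}(\alpha)\subseteq\Omega_n$ (possibly empty) to $\Omega_n$. The cycle graph $C_n$ has vertex set $\Omega_n$ and edges $\{i,i+1\}$ ($1\leqslant i\leqslant n-1$) and $\{1,n\}$; its geodesic distance is $\mathrm{d}(x,y)=\min\{|x-y|,n-|x-y|\}$. A partial isometry of $C_n$ is a partial transformation $\alpha$ of $\Omega_n$ with $\mathrm{d}(x\alpha,y\alpha)=\mathrm{d}(x,y)$ for all $x,y\in\mathrm{Dom}(\alpha)$ (such $\alpha$ is necessarily injective). The set $\mathcal{DI}_n$ of all partial isometries of $C_n$ is a monoid under composition of partial maps (written left to right). A partial transformation $\alpha$ is order-preserving [order-reversing] if $x\leqslant y$ implies $x\alpha\leqslant y\alpha$ [$x\alpha\geqslant y\alpha$] for all $x,y\in\mathrm{Dom}(\alpha)$; it is monotone if it is order-preserving or order-reversing. $\mathcal{MDI}_n$ is the set of monotone elements of $\mathcal{DI}_n$. *)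

theory Defs
  imports Complex_Main
begin

abbreviation \<Omega> :: "nat \<Rightarrow> nat set"
  where "\<Omega> n \<equiv> {1..n}"

definition partial_transformations :: "nat \<Rightarrow> (nat \<rightharpoonup> nat) set"
  where "partial_transformations n = {\<alpha>. dom \<alpha> \<subseteq> \<Omega> n \<and> ran \<alpha> \<subseteq> \<Omega> n}"

text \<open>The adjacency relation of the cycle graph, as a symmetric set of ordered pairs.\<close>

definition cycle_adj :: "nat \<Rightarrow> nat rel"
  where "cycle_adj n =
    {(x, y). x \<in> \<Omega> n \<and> y \<in> \<Omega> n \<and> (y = x + 1 \<or> x = y + 1 \<or> {x, y} = {1, n})}"

text \<open>Geodesic distance: the least length of a walk. It is only meaningful for two vertices of
  the graph; the closed form is \<open>cycle_dist_eq\<close> below.\<close>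

definition cycle_dist :: "nat \<Rightarrow> nat \<Rightarrow> nat \<Rightarrow> nat"
  where "cycle_dist n x y = (LEAST k. (x, y) \<in> cycle_adj n ^^ k)"

definition DI :: "nat \<Rightarrow> (nat \<rightharpoonup> nat) set"
  where "DI n = {\<alpha> \<in> partial_transformations n.
    \<forall>x \<in> dom \<alpha>. \<forall>y \<in> dom \<alpha>. cycle_dist n (the (\<alpha> x)) (the (\<alpha> y)) = cycle_dist n x y}"

definition order_preserving :: "(nat \<rightharpoonup> nat) \<Rightarrow> bool"
  where "order_preserving \<alpha> \<longleftrightarrow> mono_on (dom \<alpha>) (\<lambda>x. the (\<alpha> x))"

definition order_reversing :: "(nat \<rightharpoonup> nat) \<Rightarrow> bool"
  where "order_reversing \<alpha> \<longleftrightarrow> antimono_on (dom \<alpha>) (\<lambda>x. the (\<alpha> x))"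

definition MDI :: "nat \<Rightarrow> (nat \<rightharpoonup> nat) set"
  where "MDI n = {\<alpha> \<in> DI n. order_preserving \<alpha> \<or> order_reversing \<alpha>}"

lemma cycle_adj_sym: "(x, y) \<in> cycle_adj n \<Longrightarrow> (y, x) \<in> cycle_adj n"
  by (auto simp: cycle_adj_def)

lemma cycle_walk_sym: "(x, y) \<in> cycle_adj n ^^ k \<Longrightarrow> (y, x) \<in> cycle_adj n ^^ k"
proof (induction k arbitrary: y)
  case (Suc k)
  then obtain z where "(x, z) \<in> cycle_adj n ^^ k" "(z, y) \<in> cycle_adj n" by auto
  then show ?case using Suc.IH cycle_adj_sym relpow_Suc_I2 by metis
qed simp

lemma cycle_walk_up: "1 \<le> x \<Longrightarrow> x + k \<le> n \<Longrightarrow> (x, x + k) \<in> cycle_adj n ^^ k"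
proof (induction k)
  case (Suc k)
  then have "(x, x + k) \<in> cycle_adj n ^^ k" by simp
  moreover have "(x + k, x + Suc k) \<in> cycle_adj n" using Suc.prems by (auto simp: cycle_adj_def)
  ultimately show ?case by (rule relpow_Suc_I)
qed simp

lemma cycle_walk_length:
  assumes "(x, y) \<in> cycle_adj n ^^ k" "x \<in> \<Omega> n"
  shows "y \<in> \<Omega> n \<and>
    min \<bar>int x - int y\<bar> (int n - \<bar>int x - int y\<bar>) \<le> int k"
  using assms
proof (induction k arbitrary: y)
  case (Suc k)
  then obtain z where z: "(x, z) \<in> cycle_adj n ^^ k" "(z, y) \<in> cycle_adj n" by auto
  with Suc have "z \<in> \<Omega> n" "min \<bar>int x - int z\<bar> (int n - \<bar>int x - int z\<bar>) \<le> int k"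
    by auto
  moreover have "y \<in> \<Omega> n" and
    "y = z + 1 \<or> z = y + 1 \<or> (z = 1 \<and> y = n) \<or> (z = n \<and> y = 1)"
    using z(2) by (auto simp: cycle_adj_def doubleton_eq_iff)
  ultimately show ?case using Suc.prems(2) by auto
qed auto

lemma cycle_dist_eq:
  assumes "x \<in> \<Omega> n" "y \<in> \<Omega> n"
  shows "int (cycle_dist n x y) = min \<bar>int x - int y\<bar> (int n - \<bar>int x - int y\<bar>)"
proof -
  have *: "(u, v) \<in> cycle_adj n ^^ (v - u) \<and> (u, v) \<in> cycle_adj n ^^ (n - (v - u))"
    if uv: "u \<in> \<Omega> n" "v \<in> \<Omega> n" "u \<le> v" for u v
  proof
    show "(u, v) \<in> cycle_adj n ^^ (v - u)" using cycle_walk_up[of u "v - u" n] uv by simp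
    have "(u, 1) \<in> cycle_adj n ^^ (u - 1)"
      using cycle_walk_up[of 1 "u - 1" n] uv by (simp add: cycle_walk_sym)
    moreover have "(1, n) \<in> cycle_adj n" using uv by (auto simp: cycle_adj_def)
    ultimately have "(u, n) \<in> cycle_adj n ^^ Suc (u - 1)" by (rule relpow_Suc_I)
    moreover have "(n, v) \<in> cycle_adj n ^^ (n - v)"
      using cycle_walk_up[of v "n - v" n] uv by (simp add: cycle_walk_sym)
    ultimately have "(u, v) \<in> cycle_adj n ^^ (Suc (u - 1) + (n - v))"
      unfolding relpow_add by (rule relcompI)
    moreover have "Suc (u - 1) + (n - v) = n - (v - u)" using uv by auto
    ultimately show "(u, v) \<in> cycle_adj n ^^ (n - (v - u))" by metis
  qed
  define m where "m = nat (min \<bar>int x - int y\<bar> (int n - \<bar>int x - int y\<bar>))"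
  have im: "int m = min \<bar>int x - int y\<bar> (int n - \<bar>int x - int y\<bar>)"
    using assms by (auto simp: m_def)
  have "(x, y) \<in> cycle_adj n ^^ m"
  proof (cases "x \<le> y")
    case True
    then have "m = y - x \<or> m = n - (y - x)" using im assms by (auto simp: min_def split: if_splits)
    then show ?thesis using *[OF assms True] by auto
  next
    case False
    then have "m = x - y \<or> m = n - (x - y)" using im assms by (auto simp: min_def split: if_splits)
    then show ?thesis using *[OF assms(2,1)] False cycle_walk_sym[of y x m n] by auto
  qed
  moreover have "m \<le> k" if "(x, y) \<in> cycle_adj n ^^ k" for k
    using cycle_walk_length[OF that assms(1)] im by linarith
  ultimately have "cycle_dist n x y = m"
    unfolding cycle_dist_def by (intro Least_equality)
  then show ?thesis using im by simp
qed

text \<open>The submonoid properties. In left-to-right notation the product \<open>\<alpha>\<beta>\<close> of partial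
  transformations is \<open>\<beta> \<circ>\<^sub>m \<alpha>\<close>, and the identity is \<open>Some |` \<Omega> n\<close>.\<close>

lemma MDI_identity: "Some |` \<Omega> n \<in> MDI n"
  by (auto simp: MDI_def DI_def partial_transformations_def order_preserving_def
      ran_def restrict_map_def monotone_on_def split: if_splits)

lemma MDI_closed:
  assumes "\<alpha> \<in> MDI n" "\<beta> \<in> MDI n"
  shows "\<beta> \<circ>\<^sub>m \<alpha> \<in> MDI n"
proof -
  have dom: "\<exists>a b. \<alpha> x = Some a \<and> \<beta> a = Some b \<and> (\<beta> \<circ>\<^sub>m \<alpha>) x = Some b"
    if "x \<in> dom (\<beta> \<circ>\<^sub>m \<alpha>)" for x
    using that by (auto simp: map_comp_def split: option.splits)
  have pt: "\<alpha> \<in> partial_transformations n" "\<beta> \<in> partial_transformations n"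
    using assms by (auto simp: MDI_def DI_def)
  have "dom (\<beta> \<circ>\<^sub>m \<alpha>) \<subseteq> dom \<alpha>" "ran (\<beta> \<circ>\<^sub>m \<alpha>) \<subseteq> ran \<beta>"
    by (auto simp: map_comp_def ran_def split: option.splits)
  with pt have "\<beta> \<circ>\<^sub>m \<alpha> \<in> partial_transformations n"
    by (auto simp: partial_transformations_def)
  moreover have "cycle_dist n (the ((\<beta> \<circ>\<^sub>m \<alpha>) x)) (the ((\<beta> \<circ>\<^sub>m \<alpha>) y)) = cycle_dist n x y"
    if "x \<in> dom (\<beta> \<circ>\<^sub>m \<alpha>)" "y \<in> dom (\<beta> \<circ>\<^sub>m \<alpha>)" for x y
    using dom[OF that(1)] dom[OF that(2)] assms unfolding MDI_def DI_def
    by (metis (mono_tags, lifting) domI mem_Collect_eq option.sel)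
  moreover have "order_preserving (\<beta> \<circ>\<^sub>m \<alpha>) \<or> order_reversing (\<beta> \<circ>\<^sub>m \<alpha>)"
  proof -
    let ?le = "\<lambda>f. \<forall>x y a b. f x = Some a \<and> f y = Some b \<and> x \<le> y \<longrightarrow> a \<le> (b :: nat)"
    let ?ge = "\<lambda>f. \<forall>x y a b. f x = Some a \<and> f y = Some b \<and> x \<le> y \<longrightarrow> b \<le> (a :: nat)"
    have iff: "order_preserving f \<longleftrightarrow> ?le f" "order_reversing f \<longleftrightarrow> ?ge f" for f
      by (fastforce simp: order_preserving_def order_reversing_def monotone_on_def dom_def)+
    have "?le \<alpha> \<or> ?ge \<alpha>" "?le \<beta> \<or> ?ge \<beta>"
      using assms by (simp_all only: MDI_def mem_Collect_eq iff)
    then have "?le (\<beta> \<circ>\<^sub>m \<alpha>) \<or> ?ge (\<beta> \<circ>\<^sub>m \<alpha>)"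
      unfolding map_comp_Some_iff by (elim disjE) blast+
    then show ?thesis by (simp only: iff)
  qed
  ultimately show ?thesis by (simp add: MDI_def DI_def)
qed

end

theory Submission
  imports Defs
begin

text \<open>Reflecting images by \<open>y \<mapsto> n + 1 - y\<close> exchanges the order-preserving and the order-reversing
  partial isometries, and the two kinds meet exactly in the maps of rank at most 1, of which there
  are \<open>1 + n\<^sup>2\<close>. An order-preserving partial isometry sends each gap \<open>a\<close> between two domain points
  to \<open>a\<close> or to \<open>n - a\<close>. If a gap \<open>a \<noteq> n - a\<close> is replaced by \<open>n - a\<close>, no third domain point can be
  accommodated; hence the nonempty order-preserving partial isometries are the restrictions of
  translations, \<open>\<Sum>\<^bsub>|c| < n\<^esub> (2 ^ (n - |c|) - 1)\<close> in number, and the rank 2 maps that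
  turn a gap \<open>a \<noteq> n / 2\<close> into \<open>n - a\<close>, of which there are \<open>(n - a) a\<close> for each \<open>a\<close>.\<close>

section \<open>Monotone isometries, translations and gap flips\<close>

definition OPDI :: "nat \<Rightarrow> (nat \<rightharpoonup> nat) set"
  where "OPDI n = {\<alpha> \<in> DI n. order_preserving \<alpha>}"

definition ORDI :: "nat \<Rightarrow> (nat \<rightharpoonup> nat) set"
  where "ORDI n = {\<alpha> \<in> DI n. order_reversing \<alpha>}"

text \<open>The equation \<open>b + x = a + y\<close> is \<open>b - a = y - x\<close> without
  truncated subtraction. The empty map is excluded so that the shift \<open>a - x\<close> is
  determined by the map.\<close>

definition partial_translations :: "nat \<Rightarrow> (nat \<rightharpoonup> nat) set"
  where "partial_translations n = {\<alpha> \<in> partial_transformations n. \<alpha> \<noteq> Map.empty \<and>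
    (\<forall>x y a b. \<alpha> x = Some a \<longrightarrow> \<alpha> y = Some b \<longrightarrow> b + x = a + y)}"

text \<open>The equation \<open>b + y = n + a + x\<close> says that the gap \<open>y - x\<close>
  becomes \<open>n - (y - x)\<close>. The inequality rules out \<open>y - x = n / 2\<close>, where
  the map would also be a translation.\<close>

definition gap_flips :: "nat \<Rightarrow> (nat \<rightharpoonup> nat) set"
  where "gap_flips n = {\<alpha> \<in> partial_transformations n. \<exists>x y a b. x < y \<and> a < b \<and>
    \<alpha> = [x \<mapsto> a, y \<mapsto> b] \<and> b + y = n + a + x \<and> b + x \<noteq> a + y}"

section \<open>Finiteness and the gap condition\<close>

lemma finite_partial_transformations: "finite (partial_transformations n)"
  unfolding partial_transformations_def
proof (rule finite_subset)
  show "finite (\<Union>D \<in> Pow (\<Omega> n). {\<alpha>. dom \<alpha> = D \<and> ran \<alpha> \<subseteq> \<Omega> n})"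
    by (intro finite_UN_I finite_set_of_finite_maps) (auto intro: finite_subset)
qed auto

lemma partial_transformationsD:
  assumes "\<alpha> \<in> partial_transformations n" "\<alpha> x = Some a"
  shows "1 \<le> x" "x \<le> n" "1 \<le> a" "a \<le> n"
  using assms by (auto simp: partial_transformations_def dom_def ran_def)

text \<open>For gaps \<open>s\<close> and \<open>t\<close> between 0 and \<open>n - 1\<close>, the
  minima of \<open>s, n - s\<close> and of \<open>t, n - t\<close> agree exactly when
  \<open>s = t\<close> or \<open>s + t = n\<close>; both alternatives are kept in additive
  form.\<close>

lemma cycle_dist_eq_iff:
  assumes "x \<in> \<Omega> n" "y \<in> \<Omega> n" "a \<in> \<Omega> n" "b \<in> \<Omega> n" "x \<le> y" "a \<le> b"
  shows "cycle_dist n a b = cycle_dist n x y \<longleftrightarrow> b + x = a + y \<or> b + y = n + a + x"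
proof -
  have "cycle_dist n a b = cycle_dist n x y \<longleftrightarrow>
      int (cycle_dist n a b) = int (cycle_dist n x y)" by simp
  also have "\<dots> \<longleftrightarrow> b + x = a + y \<or> b + y = n + a + x"
    unfolding cycle_dist_eq[OF assms(1,2)] cycle_dist_eq[OF assms(3,4)]
    using assms by auto
  finally show ?thesis .
qed

lemma cycle_dist_commute:
  assumes "x \<in> \<Omega> n" "y \<in> \<Omega> n"
  shows "cycle_dist n x y = cycle_dist n y x"
proof -
  have "int (cycle_dist n x y) = int (cycle_dist n y x)"
    by (simp only: cycle_dist_eq[OF assms] cycle_dist_eq[OF assms(2,1)] abs_minus_commute)
  then show ?thesis by simp
qed

lemma cycle_dist_self: "cycle_dist n x x = 0"
  unfolding cycle_dist_def by (rule Least_eq_0) simp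

lemma DI_iff:
  "\<alpha> \<in> DI n \<longleftrightarrow> \<alpha> \<in> partial_transformations n \<and>
    (\<forall>x y a b. \<alpha> x = Some a \<longrightarrow> \<alpha> y = Some b \<longrightarrow> cycle_dist n a b = cycle_dist n x y)"
  by (fastforce simp: DI_def dom_def)

lemma order_preserving_iff:
  "order_preserving \<alpha> \<longleftrightarrow> (\<forall>x y a b. \<alpha> x = Some a \<longrightarrow> \<alpha> y = Some b \<longrightarrow> x \<le> y \<longrightarrow> a \<le> b)"
  by (fastforce simp: order_preserving_def monotone_on_def dom_def)

lemma order_reversing_iff:
  "order_reversing \<alpha> \<longleftrightarrow> (\<forall>x y a b. \<alpha> x = Some a \<longrightarrow> \<alpha> y = Some b \<longrightarrow> x \<le> y \<longrightarrow> b \<le> a)"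
  by (fastforce simp: order_reversing_def monotone_on_def dom_def)

text \<open>Strictly increasing pairs suffice: equal points have distance 0 on both sides, and
  decreasing pairs follow by symmetry of the distance.\<close>

lemma OPDI_iff:
  "\<alpha> \<in> OPDI n \<longleftrightarrow> \<alpha> \<in> partial_transformations n \<and>
    (\<forall>x y a b. \<alpha> x = Some a \<longrightarrow> \<alpha> y = Some b \<longrightarrow> x < y \<longrightarrow>
      a < b \<and> (b + x = a + y \<or> b + y = n + a + x))"
    (is "?L \<longleftrightarrow> ?R")
proof
  assume L: ?L
  then have pt: "\<alpha> \<in> partial_transformations n" by (simp add: OPDI_def DI_iff)
  show ?R
  proof (intro conjI allI impI pt)
    fix x y a b assume xy: "\<alpha> x = Some a" "\<alpha> y = Some b" "x < y"
    note r = partial_transformationsD[OF pt xy(1)] partial_transformationsD[OF pt xy(2)]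
    have le: "a \<le> b" using L xy less_imp_le unfolding OPDI_def order_preserving_iff by blast
    have "cycle_dist n a b = cycle_dist n x y" using L xy by (auto simp: OPDI_def DI_iff)
    then show eq: "b + x = a + y \<or> b + y = n + a + x"
      using cycle_dist_eq_iff[of x n y a b] r le xy(3) by simp
    \<comment> \<open>Equality \<open>a = b\<close> would force \<open>y = x\<close> or
      \<open>y = n + x\<close>, against \<open>1 \<le> x\<close>, \<open>x < y\<close> and
      \<open>y \<le> n\<close>.\<close>
    then show "a < b" using le xy(3) r by auto
  qed
next
  assume R: ?R
  then have pt: "\<alpha> \<in> partial_transformations n" by simp
  have *: "a \<le> b \<and> cycle_dist n a b = cycle_dist n x y"
    if xy: "\<alpha> x = Some a" "\<alpha> y = Some b" "x \<le> y" for x y a b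
  proof (cases "x = y")
    case True
    then show ?thesis using xy cycle_dist_eq_iff[of x n x a a]
        partial_transformationsD[OF pt xy(1)] by simp
  next
    case False
    then have "a < b \<and> (b + x = a + y \<or> b + y = n + a + x)" using R xy by simp
    then show ?thesis using cycle_dist_eq_iff[of x n y a b] xy(3)
        partial_transformationsD[OF pt xy(1)] partial_transformationsD[OF pt xy(2)] by simp
  qed
  have "cycle_dist n a b = cycle_dist n x y" if xy: "\<alpha> x = Some a" "\<alpha> y = Some b" for x y a b
  proof (cases "x \<le> y")
    case True
    then show ?thesis using * xy by blast
  next
    case False
    then have "cycle_dist n b a = cycle_dist n y x" using *[OF xy(2,1)] by simp
    then show ?thesis
      using cycle_dist_commute[of a n b] cycle_dist_commute[of x n y]
        partial_transformationsD[OF pt xy(1)] partial_transformationsD[OF pt xy(2)] by simp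
  qed
  with * pt show ?L unfolding OPDI_def mem_Collect_eq DI_iff order_preserving_iff by blast
qed

section \<open>Classification of the order-preserving partial isometries\<close>

text \<open>Of three points, the outer gap is the sum of the inner gaps \<open>g\<close> and
  \<open>h\<close>, before and after mapping. If only \<open>g\<close> is flipped, the outer image
  gap \<open>n - g + h\<close> equals \<open>g + h\<close> only if \<open>2 * g = n\<close>, and
  \<open>n - g - h\<close> only if \<open>h = 0\<close>. If both are flipped, it is
  \<open>2 * n - g - h > n\<close>, too large. If neither is, the outer gap is flipped only if it is
  \<open>n / 2\<close>. The hypotheses on \<open>z\<close> are implications so that one statement
  covers its three possible positions.\<close>

lemma gap_flip_no_third_point:
  fixes a b c x y z n :: nat
  assumes "x < y" "a < b" "b + y = n + a + x" "b + x \<noteq> a + y"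
    and "x < z \<longrightarrow> a < c \<and> (c + x = a + z \<or> c + z = n + a + x)"
    and "z < x \<longrightarrow> c < a \<and> (a + z = c + x \<or> a + x = n + c + z)"
    and "y < z \<longrightarrow> b < c \<and> (c + y = b + z \<or> c + z = n + b + y)"
    and "z < y \<longrightarrow> c < b \<and> (b + z = c + y \<or> b + y = n + c + z)"
    and "1 \<le> a" "a \<le> n" "1 \<le> b" "b \<le> n" "1 \<le> c" "c \<le> n"
    and "1 \<le> x" "y \<le> n" "1 \<le> z" "z \<le> n"
  shows "z = x \<or> z = y"
proof (rule ccontr)
  assume "\<not> (z = x \<or> z = y)"
  then consider "z < x" | "x < z" "z < y" | "y < z" by linarith
  then show False
  proof cases
    case 1
    then have "a + z = c + x \<or> a + x = n + c + z" "b + z = c + y \<or> b + y = n + c + z" "c < a"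
      using assms by simp_all
    then show False using assms(1-4) assms(9-) 1 by (elim disjE) linarith+
  next
    case 2
    then have "c + x = a + z \<or> c + z = n + a + x" "b + z = c + y \<or> b + y = n + c + z" "a < c" "c < b"
      using assms by simp_all
    then show False using assms(1-4) assms(9-) 2 by (elim disjE) linarith+
  next
    case 3
    then have "c + x = a + z \<or> c + z = n + a + x" "c + y = b + z \<or> c + z = n + b + y" "b < c"
      using assms by simp_all
    then show False using assms(1-4) assms(9-) 3 by (elim disjE) linarith+
  qed
qed

lemma OPDI_eq: "OPDI n = insert Map.empty (partial_translations n \<union> gap_flips n)"
proof (intro equalityI subsetI)
  fix \<alpha> assume A: "\<alpha> \<in> OPDI n"
  then have pt: "\<alpha> \<in> partial_transformations n" by (simp add: OPDI_iff)
  have pair: "a < b \<and> (b + x = a + y \<or> b + y = n + a + x)"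
    if "\<alpha> x = Some a" "\<alpha> y = Some b" "x < y" for x y a b
    using A that unfolding OPDI_iff by blast
  show "\<alpha> \<in> insert Map.empty (partial_translations n \<union> gap_flips n)"
  \<comment> \<open>A gap that is not kept must be flipped and differs from \<open>n / 2\<close>, so
    its two endpoints exhaust the domain. If every gap is kept, all points have the same
    shift.\<close>
  proof (cases "\<exists>x y a b. \<alpha> x = Some a \<and> \<alpha> y = Some b \<and> x < y \<and> b + x \<noteq> a + y")
    case True
    then obtain x y a b where xy: "\<alpha> x = Some a" "\<alpha> y = Some b" "x < y" "b + x \<noteq> a + y" by blast
    with pair have flip: "a < b" "b + y = n + a + x" by blast+
    have only: "z = x \<or> z = y" if z: "\<alpha> z = Some c" for z c
      using xy(3) flip xy(4) pair[OF xy(1) z] pair[OF z xy(1)] pair[OF xy(2) z] pair[OF z xy(2)]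
        partial_transformationsD[OF pt xy(1)] partial_transformationsD[OF pt xy(2)]
        partial_transformationsD[OF pt z]
      by (intro gap_flip_no_third_point[of x y a b n z c] impI) simp_all
    have "\<alpha> = [x \<mapsto> a, y \<mapsto> b]"
    proof
      fix z show "\<alpha> z = [x \<mapsto> a, y \<mapsto> b] z"
        using xy only by (cases "\<alpha> z") auto
    qed
    then have "\<alpha> \<in> gap_flips n" using pt xy flip unfolding gap_flips_def by blast
    then show ?thesis by simp
  next
    case False
    have "b + x = a + y" if "\<alpha> x = Some a" "\<alpha> y = Some b" for x y a b
      using False that by (cases x y rule: linorder_cases) (fastforce simp: add.commute)+
    then show ?thesis using pt unfolding partial_translations_def by blast
  qed
next
  fix \<alpha> assume "\<alpha> \<in> insert Map.empty (partial_translations n \<union> gap_flips n)"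
  then consider "\<alpha> = Map.empty" | "\<alpha> \<in> partial_translations n" | "\<alpha> \<in> gap_flips n" by blast
  then show "\<alpha> \<in> OPDI n"
  proof cases
    case 1
    then show ?thesis by (simp add: OPDI_iff partial_transformations_def)
  next
    case 2
    have "a < b \<and> b + x = a + y" if "\<alpha> x = Some a" "\<alpha> y = Some b" "x < y" for x y a b
    proof -
      have "b + x = a + y" using 2 that unfolding partial_translations_def by blast
      then show ?thesis using \<open>x < y\<close> by linarith
    qed
    then show ?thesis using 2 unfolding OPDI_iff partial_translations_def by blast
  next
    case 3
    then obtain x y a b where pt: "\<alpha> \<in> partial_transformations n" and xy: "x < y" "a < b"
      "b + y = n + a + x" and \<alpha>: "\<alpha> = [x \<mapsto> a, y \<mapsto> b]"
      unfolding gap_flips_def by blast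
    \<comment> \<open>The domain has a single increasing pair, so the pairwise criterion is checked
      on \<open>x < y\<close> alone.\<close>
    have "u = x \<and> c = a \<and> v = y \<and> d = b" if "\<alpha> u = Some c" "\<alpha> v = Some d" "u < v" for u v c d
      using that xy(1) by (auto simp: \<alpha> split: if_splits)
    then show ?thesis using pt xy unfolding OPDI_iff by blast
  qed
qed

section \<open>Counting translations\<close>

text \<open>A nonempty partial translation is a shift \<open>c\<close> with \<open>|c| < n\<close>
  together with a nonempty set \<open>D\<close> of points that the shift keeps inside
  \<open>\<Omega> n\<close>. There are \<open>n - |c|\<close> such points, hence
  \<open>2 ^ (n - |c|) - 1\<close> choices of \<open>D\<close>.\<close>

lemma card_partial_translations:
  assumes "n \<ge> 1"
  shows "int (card (partial_translations n)) = 3 * 2 ^ n - 2 * int n - 3"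
proof -
  define I where "I c = {x \<in> \<Omega> n. 1 \<le> int x + c \<and> int x + c \<le> int n}" for c
  define t where "t = (\<lambda>(c, D) x. if x \<in> D then Some (nat (int x + c)) else None)"
  define P where "P = (SIGMA c : {- int n <..< int n}. Pow (I c) - {{}})"
  have I_card: "card (I c) = n - nat \<bar>c\<bar>" if "c \<in> {- int n <..< int n}" for c
  proof -
    have "I c = {nat (max 1 (1 - c)) .. nat (min (int n) (int n - c))}"
      using that by (auto simp: I_def)
    then show ?thesis using that by (auto simp: max_def min_def nat_diff_distrib)
  qed
  have "bij_betw t P (partial_translations n)"
  proof (rule bij_betwI')
    fix p q assume pq: "p \<in> P" "q \<in> P"
    obtain c D c' D' where [simp]: "p = (c, D)" "q = (c', D')" by (meson surj_pair)
    show "t p = t q \<longleftrightarrow> p = q"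
    proof
      assume eq: "t p = t q"
      have "D = D'"
      proof (rule set_eqI)
        fix x show "x \<in> D \<longleftrightarrow> x \<in> D'" using fun_cong[OF eq, of x] by (auto simp: t_def split: if_splits)
      qed
      \<comment> \<open>Nonemptiness of \<open>D\<close> supplies a point at which the shifts are
        compared; membership in \<open>I c\<close> and \<open>I c'\<close> makes both arguments of
        \<open>nat\<close> positive there.\<close>
      moreover obtain x where x: "x \<in> D" using pq by (auto simp: P_def)
      moreover have "x \<in> I c" "x \<in> I c'" using x \<open>D = D'\<close> pq by (auto simp: P_def)
      ultimately show "p = q"
        using fun_cong[OF eq, of x] by (auto simp: t_def I_def)
    qed simp
  next
    fix p assume p: "p \<in> P"
    obtain c D where [simp]: "p = (c, D)" by (meson surj_pair)
    obtain z where z: "z \<in> D" using p by (auto simp: P_def)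
    have D: "D \<subseteq> I c" using p by (auto simp: P_def)
    have img: "x \<in> \<Omega> n \<and> a \<in> \<Omega> n \<and> int a = int x + c" if "t p x = Some a" for x a
    proof -
      have "x \<in> D" "a = nat (int x + c)" using that by (auto simp: t_def split: if_splits)
      moreover from this D have "x \<in> I c" by blast
      ultimately show ?thesis by (auto simp: I_def)
    qed
    then have "t p \<in> partial_transformations n"
      unfolding partial_transformations_def dom_def ran_def by blast
    moreover have "t p \<noteq> Map.empty"
      using z by (auto simp: t_def fun_eq_iff)
    moreover have "b + x = a + y" if "t p x = Some a" "t p y = Some b" for x y a b
      using img[OF that(1)] img[OF that(2)] by linarith
    ultimately show "t p \<in> partial_translations n" unfolding partial_translations_def by blast
  next
    fix \<alpha> assume A: "\<alpha> \<in> partial_translations n"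
    then have pt: "\<alpha> \<in> partial_transformations n" by (simp add: partial_translations_def)
    obtain x a where xa: "\<alpha> x = Some a" using A by (auto simp: partial_translations_def fun_eq_iff)
    define c where "c = int a - int x"
    have img: "int b = int y + c" if "\<alpha> y = Some b" for y b
    proof -
      have "b + x = a + y" using A xa that unfolding partial_translations_def by blast
      then show ?thesis unfolding c_def by linarith
    qed
    have "\<alpha> = t (c, dom \<alpha>)"
    proof
      fix y show "\<alpha> y = t (c, dom \<alpha>) y"
        by (cases "\<alpha> y") (auto simp: t_def dom_def simp flip: img)
    qed
    moreover have "(c, dom \<alpha>) \<in> P"
    proof -
      have "dom \<alpha> \<subseteq> I c"
      proof
        fix y assume "y \<in> dom \<alpha>"
        then obtain b where "\<alpha> y = Some b" by blast
        then show "y \<in> I c"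
          using img[of y b] partial_transformationsD[OF pt, of y b] by (simp add: I_def)
      qed
      then show ?thesis
        using partial_transformationsD[OF pt xa] xa by (auto simp: P_def c_def)
    qed
    ultimately show "\<exists>p\<in>P. \<alpha> = t p" by blast
  qed
  then have "card (partial_translations n) = card P" by (simp add: bij_betw_same_card)
  also have "card P = (\<Sum>c \<in> {- int n <..< int n}. card (Pow (I c) - {{}}))"
    unfolding P_def by (rule card_SigmaI) (auto simp: I_def)
  also have "\<dots> = (\<Sum>c \<in> {- int n <..< int n}. 2 ^ (n - nat \<bar>c\<bar>) - 1)"
  proof (rule sum.cong)
    fix c assume "c \<in> {- int n <..< int n}"
    moreover have "finite (I c)" by (simp add: I_def)
    ultimately show "card (Pow (I c) - {{}}) = 2 ^ (n - nat \<bar>c\<bar>) - 1"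
      using I_card[of c] by (simp add: card_Diff_subset card_Pow)
  qed simp
  finally have "int (card (partial_translations n)) =
      (\<Sum>c \<in> {- int n <..< int n}. 2 ^ (n - nat \<bar>c\<bar>) - 1)"
    by (simp add: of_nat_diff)
  \<comment> \<open>The range is split by the sign of \<open>c\<close>, with 0 put into the first
    half only; the summand depends on \<open>|c|\<close> alone.\<close>
  also have "{- int n <..< int n} = int ` {..<n} \<union> (\<lambda>k. - int k) ` {1..<n}" (is "_ = ?U \<union> ?V")
  proof (intro equalityI subsetI)
    fix c assume "c \<in> {- int n <..< int n}"
    then show "c \<in> ?U \<union> ?V"
      by (cases c rule: int_cases3) auto
  qed auto
  also have "(\<Sum>c \<in> ?U \<union> ?V. 2 ^ (n - nat \<bar>c\<bar>) - 1) =
      (\<Sum>c \<in> ?U. 2 ^ (n - nat \<bar>c\<bar>) - 1) + (\<Sum>c \<in> ?V. 2 ^ (n - nat \<bar>c\<bar>) - (1::int))"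
    by (rule sum.union_disjoint) auto
  also have "\<dots> = (\<Sum>k<n. 2 ^ (n - k) - 1) + (\<Sum>k=1..<n. 2 ^ (n - k) - 1)"
    by (simp add: sum.reindex inj_on_def)
  \<comment> \<open>The second half is the first without its term at \<open>k = 0\<close>, which is
    \<open>2 ^ n - 1\<close>.\<close>
  also have "(\<Sum>k=1..<n. 2 ^ (n - k) - (1::int)) = (\<Sum>k<n. 2 ^ (n - k) - 1) - (2 ^ n - 1)"
    using assms by (simp add: lessThan_atLeast0 sum.atLeast_Suc_lessThan[of 0 n])
  also have "(\<Sum>k<n. 2 ^ (n - k) - (1::int)) = 2 * 2 ^ n - 2 - int n"
  proof (induction n)
    case (Suc n)
    then show ?case by (simp add: sum.lessThan_Suc_shift del: sum.lessThan_Suc)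
  qed simp
  finally show ?thesis by simp
qed

section \<open>Counting gap flips\<close>

text \<open>A flip is given by its gap \<open>g\<close>, its smaller point \<open>x\<close> and the
  image \<open>a\<close> of \<open>x\<close>. The bounds \<open>x + g \<le> n\<close> and
  \<open>a + (n - g) \<le> n\<close> leave \<open>n - g\<close> choices of \<open>x\<close> and
  \<open>g\<close> choices of \<open>a\<close>. Summing over all \<open>g\<close> gives the cubic
  term; the quadratic term removes \<open>g = n / 2\<close>.\<close>

lemma card_gap_flips:
  "real (card (gap_flips n)) =
    (real n + 1) * real n * (real n - 1) / 6 - (1 + (-1) ^ n) / 8 * (real n)\<^sup>2"
proof -
  define P where "P = (SIGMA g : {1..<n} - {g. 2 * g = n}. {1..n - g} \<times> {1..g})"
  define f where "f = (\<lambda>(g, x, a). [x \<mapsto> a, x + g \<mapsto> a + (n - g)])"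
  have "bij_betw f P (gap_flips n)"
  proof (rule bij_betwI')
    fix p q assume pq: "p \<in> P" "q \<in> P"
    obtain g x a g' x' a' where [simp]: "p = (g, x, a)" "q = (g', x', a')" by (metis surj_pair)
    show "f p = f q \<longleftrightarrow> p = q"
    proof
      assume eq: "f p = f q"
      have pos: "g > 0" "g' > 0" using pq by (auto simp: P_def)
      have "{x, x + g} = {x', x' + g'}"
        using arg_cong[OF eq, of dom] by (auto simp: f_def)
      with pos have "x = x'" "g = g'" by (auto simp: doubleton_eq_iff)
      moreover from this have "a = a'"
        using fun_cong[OF eq, of x] pos by (simp add: f_def)
      ultimately show "p = q" by simp
    qed simp
  next
    fix p assume p: "p \<in> P"
    obtain g x a where [simp]: "p = (g, x, a)" by (metis surj_pair)
    have "f p \<in> partial_transformations n"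
      using p by (auto simp: P_def f_def partial_transformations_def)
    moreover have "x < x + g" "a < a + (n - g)" "f p = [x \<mapsto> a, x + g \<mapsto> a + (n - g)]"
      "a + (n - g) + (x + g) = n + a + x" "a + (n - g) + x \<noteq> a + (x + g)"
      using p by (auto simp: P_def f_def)
    ultimately show "f p \<in> gap_flips n" unfolding gap_flips_def by blast
  next
    fix \<alpha> assume "\<alpha> \<in> gap_flips n"
    then obtain x y a b where pt: "\<alpha> \<in> partial_transformations n" and xy: "x < y" "a < b"
      "\<alpha> = [x \<mapsto> a, y \<mapsto> b]" "b + y = n + a + x" "b + x \<noteq> a + y"
      unfolding gap_flips_def by blast
    have "\<alpha> x = Some a" "\<alpha> y = Some b" using xy by auto
    note r = partial_transformationsD[OF pt this(1)] partial_transformationsD[OF pt this(2)]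
    have "(y - x, x, a) \<in> P" using xy r by (auto simp: P_def)
    moreover have "b = a + (n - (y - x))" using xy r by auto
    then have "\<alpha> = f (y - x, x, a)" using xy r by (simp add: f_def)
    ultimately show "\<exists>p\<in>P. \<alpha> = f p" by blast
  qed
  then have "card (gap_flips n) = card P" by (simp add: bij_betw_same_card)
  also have "\<dots> = (\<Sum>g \<in> {1..<n} - {g. 2 * g = n}. (n - g) * g)"
    unfolding P_def by (subst card_SigmaI) (auto simp: card_cartesian_product)
  finally have "real (card (gap_flips n)) =
      (\<Sum>g \<in> {1..<n} - {g. 2 * g = n}. (real n - real g) * real g)"
    by (simp add: of_nat_diff)
  also have "\<dots> = (\<Sum>g=1..<n. (real n - real g) * real g) -
      (\<Sum>g \<in> {1..<n} \<inter> {g. 2 * g = n}. (real n - real g) * real g)"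
    by (subst sum.Int_Diff[where A = "{1..<n}" and B = "{g. 2 * g = n}"]) auto
  also have "(\<Sum>g=1..<n. (real n - real g) * real g) = (real n + 1) * real n * (real n - 1) / 6"
  proof -
    \<comment> \<open>The upper limit \<open>m\<close> is separated from the \<open>n\<close> in the
      summand so that the induction varies only \<open>m\<close>.\<close>
    have "(\<Sum>g<m. (real n - real g) * real g) =
        real m * (real m - 1) * (3 * real n - 2 * real m + 1) / 6" for m
      by (induction m) (simp_all add: field_simps)
    from this[of n] have "(\<Sum>g<n. (real n - real g) * real g) =
        (real n + 1) * real n * (real n - 1) / 6" by (simp add: algebra_simps)
    moreover have "(\<Sum>g=1..<n. (real n - real g) * real g) = (\<Sum>g<n. (real n - real g) * real g)"
      by (rule sum.mono_neutral_left) auto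
    ultimately show ?thesis by simp
  qed
  \<comment> \<open>The factor \<open>(1 + (-1) ^ n) / 8\<close> is 1/4 for even \<open>n\<close>
    and 0 for odd \<open>n\<close>. For \<open>n = 2 * h\<close> with \<open>h > 0\<close> the only
    term is \<open>h * h\<close>, a quarter of the square of \<open>n\<close>.\<close>
  also have "(\<Sum>g \<in> {1..<n} \<inter> {g. 2 * g = n}. (real n - real g) * real g) =
      (1 + (-1) ^ n) / 8 * (real n)\<^sup>2"
  proof (cases "even n")
    case True
    then obtain h where h: "n = 2 * h" by blast
    then have "{1..<n} \<inter> {g. 2 * g = n} = (if h = 0 then {} else {h})" by auto
    then show ?thesis using h by (simp add: power2_eq_square)
  next
    case False
    then have "{1..<n} \<inter> {g. 2 * g = n} = {}" by auto
    then show ?thesis using False by simp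
  qed
  finally show ?thesis .
qed

text \<open>Adds the counts of the three disjoint classes; the empty map contributes 1, turning the
  constant -3 of the translations into -2.\<close>

lemma card_OPDI:
  assumes "n \<ge> 1"
  shows "real (card (OPDI n)) = 3 * 2 ^ n - 2 * real n - 2 +
    (real n + 1) * real n * (real n - 1) / 6 - (1 + (-1) ^ n) / 8 * (real n)\<^sup>2"
proof -
  have fin: "finite (partial_translations n)" "finite (gap_flips n)"
    by (auto simp: partial_translations_def gap_flips_def
        intro: finite_subset[OF _ finite_partial_transformations[of n]])
  have "\<alpha> \<notin> partial_translations n" if flip: "\<alpha> \<in> gap_flips n" for \<alpha>
  proof
    assume tr: "\<alpha> \<in> partial_translations n"
    obtain x y a b where "\<alpha> = [x \<mapsto> a, y \<mapsto> b]" "x < y" and ne: "b + x \<noteq> a + y"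
      using flip unfolding gap_flips_def by blast
    then have "\<alpha> x = Some a" "\<alpha> y = Some b" by auto
    with tr ne show False unfolding partial_translations_def by blast
  qed
  then have "partial_translations n \<inter> gap_flips n = {}" by blast
  moreover have "Map.empty \<notin> partial_translations n \<union> gap_flips n"
    by (simp add: partial_translations_def gap_flips_def) (metis map_upd_nonempty)
  ultimately have "card (OPDI n) = 1 + card (partial_translations n) + card (gap_flips n)"
    using fin by (simp add: OPDI_eq card_Un_disjoint)
  moreover have "real (card (partial_translations n)) = 3 * 2 ^ n - 2 * real n - 3"
    using arg_cong[OF card_partial_translations[OF assms], of real_of_int] by simp
  ultimately show ?thesis by (simp add: card_gap_flips)
qed

section \<open>Reflection of images\<close>

definition reflect :: "nat \<Rightarrow> (nat \<rightharpoonup> nat) \<Rightarrow> (nat \<rightharpoonup> nat)"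
  where "reflect n \<alpha> = (\<lambda>x. map_option (\<lambda>y. n + 1 - y) (\<alpha> x))"

text \<open>Images lie between 1 and \<open>n\<close>, so the truncated subtraction
  \<open>n + 1 - y\<close> loses nothing, stays in this range and is an involution.\<close>

lemma reflect_partial_transformations:
  assumes "\<alpha> \<in> partial_transformations n"
  shows "reflect n \<alpha> \<in> partial_transformations n" and "reflect n (reflect n \<alpha>) = \<alpha>"
proof -
  show "reflect n \<alpha> \<in> partial_transformations n"
    using assms partial_transformationsD[OF assms]
    by (fastforce simp: reflect_def partial_transformations_def dom_def ran_def)
  show "reflect n (reflect n \<alpha>) = \<alpha>"
  proof
    fix x show "reflect n (reflect n \<alpha>) x = \<alpha> x"
      using partial_transformationsD[OF assms, of x] by (cases "\<alpha> x") (auto simp: reflect_def)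
  qed
qed

text \<open>Reflection preserves \<open>|a - b|\<close>, and the cycle distance depends on nothing
  else.\<close>

lemma reflect_DI:
  assumes "\<alpha> \<in> DI n"
  shows "reflect n \<alpha> \<in> DI n"
proof -
  have pt: "\<alpha> \<in> partial_transformations n" using assms by (simp add: DI_iff)
  have "cycle_dist n a b = cycle_dist n x y"
    if xy: "reflect n \<alpha> x = Some a" "reflect n \<alpha> y = Some b" for x y a b
  proof -
    obtain a' b' where \<alpha>: "\<alpha> x = Some a'" "\<alpha> y = Some b'" and ab: "a = n + 1 - a'" "b = n + 1 - b'"
      using xy by (auto simp: reflect_def)
    note r = partial_transformationsD[OF pt \<alpha>(1)] partial_transformationsD[OF pt \<alpha>(2)]
    have "int (cycle_dist n a b) = int (cycle_dist n a' b')"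
      using r by (subst (1 2) cycle_dist_eq) (auto simp: ab of_nat_diff abs_minus_commute)
    then show ?thesis using assms \<alpha> by (simp add: DI_iff)
  qed
  then show ?thesis using reflect_partial_transformations(1)[OF pt] by (simp add: DI_iff)
qed

text \<open>Reflection reverses the order of images and is its own inverse, so it is a bijection
  between the two classes.\<close>

lemma card_ORDI: "card (ORDI n) = card (OPDI n)"
proof -
  have pt: "\<alpha> \<in> partial_transformations n" if "\<alpha> \<in> DI n" for \<alpha>
    using that by (simp add: DI_iff)
  have op: "reflect n \<alpha> \<in> OPDI n" if "\<alpha> \<in> ORDI n" for \<alpha>
    using that reflect_DI[of \<alpha> n]
    by (fastforce simp: OPDI_def ORDI_def order_preserving_iff order_reversing_iff reflect_def
        intro: diff_le_mono2)
  have or: "reflect n \<alpha> \<in> ORDI n" if "\<alpha> \<in> OPDI n" for \<alpha>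
    using that reflect_DI[of \<alpha> n]
    by (fastforce simp: OPDI_def ORDI_def order_preserving_iff order_reversing_iff reflect_def
        intro: diff_le_mono2)
  have "bij_betw (reflect n) (ORDI n) (OPDI n)"
    by (rule bij_betw_byWitness[where f' = "reflect n"])
      (auto simp: op or, auto simp: ORDI_def OPDI_def pt reflect_partial_transformations(2))
  then show ?thesis by (rule bij_betw_same_card)
qed

section \<open>Inclusion-exclusion\<close>

text \<open>Two domain points \<open>x < y\<close> would have images with both \<open>a < b\<close>
  and \<open>b \<le> a\<close>, so the rank is at most 1. Conversely, every such map qualifies, its
  only distances being 0: the empty map and one map for each pair of a point and its image.\<close>

lemma card_OPDI_Int_ORDI: "card (OPDI n \<inter> ORDI n) = 1 + n\<^sup>2"
proof -
  define S where "S = (\<lambda>(x, a). [x \<mapsto> a]) ` (\<Omega> n \<times> \<Omega> n)"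
  have "OPDI n \<inter> ORDI n = insert Map.empty S"
  proof (intro equalityI subsetI)
    fix \<alpha> assume A: "\<alpha> \<in> OPDI n \<inter> ORDI n"
    then have pt: "\<alpha> \<in> partial_transformations n" by (simp add: OPDI_iff)
    have less: False if "\<alpha> x = Some a" "\<alpha> y = Some b" "x < y" for x y a b
    proof -
      have "a < b" using IntD1[OF A] that unfolding OPDI_iff by blast
      moreover have "b \<le> a"
        using IntD2[OF A] that less_imp_le unfolding ORDI_def order_reversing_iff by blast
      ultimately show False by simp
    qed
    show "\<alpha> \<in> insert Map.empty S"
    proof (cases "\<alpha> = Map.empty")
      case False
      then obtain x a where xa: "\<alpha> x = Some a" by (auto simp: fun_eq_iff)
      have "\<alpha> = [x \<mapsto> a]"
      proof
        fix y show "\<alpha> y = [x \<mapsto> a] y"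
          using xa less[OF xa, of y] less[OF _ xa, of y]
          by (cases "\<alpha> y"; cases x y rule: linorder_cases) auto
      qed
      then show ?thesis using partial_transformationsD[OF pt xa] by (auto simp: S_def)
    qed simp
  next
    fix \<alpha> assume "\<alpha> \<in> insert Map.empty S"
    then show "\<alpha> \<in> OPDI n \<inter> ORDI n"
      by (auto simp: S_def cycle_dist_self OPDI_def ORDI_def DI_iff partial_transformations_def
          order_preserving_iff order_reversing_iff split: if_splits)
  qed
  moreover have "x = x' \<and> a = a'" if "[x \<mapsto> a] = [x' \<mapsto> a']" for x x' a a' :: nat
    using fun_cong[OF that, of x] by (simp split: if_splits)
  then have "inj_on (\<lambda>(x, a). [x \<mapsto> a]) (\<Omega> n \<times> \<Omega> n)"
    by (fastforce simp: inj_on_def)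
  then have "card S = n\<^sup>2"
    by (simp add: S_def card_image card_cartesian_product power2_eq_square)
  moreover have "Map.empty \<notin> S" "finite S" by (auto simp: S_def map_upd_nonempty[symmetric])
  ultimately show ?thesis by simp
qed

theorem theorem2p3:
  fixes n :: nat
  assumes "n \<ge> 3"
  shows "real (card (MDI n)) =
    3 * 2 ^ (n + 1) + (real n + 1) * real n * (real n - 1) / 3
      - (5 + (-1) ^ n) / 4 * (real n)\<^sup>2 - 4 * real n - 5"
proof -
  have "finite (OPDI n)" "finite (ORDI n)"
    by (auto simp: OPDI_def ORDI_def DI_def
        intro: finite_subset[OF _ finite_partial_transformations[of n]])
  moreover have "MDI n = OPDI n \<union> ORDI n" by (auto simp: MDI_def OPDI_def ORDI_def)
  \<comment> \<open>The count stays additive over the naturals; subtraction is made only over the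
    reals.\<close>
  ultimately have "card (OPDI n) + card (ORDI n) = card (MDI n) + (1 + n\<^sup>2)"
    using card_Un_Int[of "OPDI n" "ORDI n"] card_OPDI_Int_ORDI by simp
  then have "real (card (MDI n)) = 2 * real (card (OPDI n)) - 1 - (real n)\<^sup>2"
    using card_ORDI[of n] by (simp flip: of_nat_power)
  \<comment> \<open>Doubling makes the quadratic coefficient \<open>- (1 + (-1) ^ n) / 4\<close> and
    the constant -4; removing the intersection lowers each by 1.\<close>
  also have "\<dots> = 3 * 2 ^ (n + 1) + (real n + 1) * real n * (real n - 1) / 3
      - (5 + (-1) ^ n) / 4 * (real n)\<^sup>2 - 4 * real n - 5"
    using assms by (simp add: card_OPDI field_simps)
  finally show ?thesis .
qed

end
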